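(* The path-covering number is stable under 2-switch: for every graph $G$ and every 2-switch $\tau$, $|\pi(\tau(G))-\pi(G)|\le 1$.
   Context: Graphs are finite, simple, undirected and labeled. A path covering of $G$ is a set of pairwise vertex-disjoint paths of $G$ (a single vertex counts as a path) containing all vertices of $G$; $\pi(G)$ is the minimum number of paths in a path covering of $G$. For vertices $a,b,c,d$, the 2-switch $\tau=\binom{a\ b}{c\ d}$ maps $G$ to $G-ab-cd+ac+bd$ if $ab,cd\in E(G)$, $\{a,b\}\cap\{c,d\}=\varnothing$ and $ac,bd\notin E(G)$, and to $G$ otherwise. *)

theory Defs
  imports Main
begin

record 'a ugraph =
  verts :: "'a set"
  edges :: "'a set set"

definition simple_graph :: "'a ugraph \<Rightarrow> bool" where
  "simple_graph G \<longleftrightarrow>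
     finite (verts G) \<and> (\<forall>e \<in> edges G. e \<subseteq> verts G \<and> card e = 2)"

text \<open>A path is given by its sequence of vertices. The two sequences \<open>p\<close> and \<open>rev p\<close>
  describe the same path; as they share vertices, at most one of them can occur in a
  path covering, so counting sequences there is the same as counting paths.\<close>

definition is_path :: "'a ugraph \<Rightarrow> 'a list \<Rightarrow> bool" where
  "is_path G p \<longleftrightarrow>
     p \<noteq> [] \<and> distinct p \<and> set p \<subseteq> verts G \<and> successively (\<lambda>u v. {u, v} \<in> edges G) p"

definition path_covering :: "'a ugraph \<Rightarrow> 'a list set \<Rightarrow> bool" where
  "path_covering G P \<longleftrightarrow>
     (\<forall>p \<in> P. is_path G p) \<and>
     (\<forall>p \<in> P. \<forall>q \<in> P. p \<noteq> q \<longrightarrow> set p \<inter> set q = {}) \<and>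
     (\<Union>p \<in> P. set p) = verts G"

definition path_covering_number :: "'a ugraph \<Rightarrow> nat" where
  "path_covering_number G = (LEAST k. \<exists>P. path_covering G P \<and> card P = k)"

definition two_switch :: "'a \<Rightarrow> 'a \<Rightarrow> 'a \<Rightarrow> 'a \<Rightarrow> 'a ugraph \<Rightarrow> 'a ugraph" where
  "two_switch a b c d G =
     (if {a, b} \<in> edges G \<and> {c, d} \<in> edges G \<and> {a, b} \<inter> {c, d} = {} \<and>
         {a, c} \<notin> edges G \<and> {b, d} \<notin> edges G
      then G\<lparr>edges := (edges G - {{a, b}, {c, d}}) \<union> {{a, c}, {b, d}}\<rparr>
      else G)"

lemma simple_graph_two_switch:
  assumes "simple_graph G"
  shows "simple_graph (two_switch a b c d G)"
  using assms unfolding simple_graph_def two_switch_def by (auto simp: card_2_iff)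

text \<open>Path coverings are finite (so \<open>card\<close> really counts their paths), and every graph has
  one (so the minimum is attained).\<close>

lemma finite_path_covering:
  assumes "simple_graph G" "path_covering G P"
  shows "finite P"
proof (rule finite_subset)
  show "P \<subseteq> {p. set p \<subseteq> verts G \<and> distinct p}"
    using assms(2) by (auto simp: path_covering_def is_path_def)
  show "finite {p. set p \<subseteq> verts G \<and> distinct p}"
    using assms(1) by (intro finite_subset_distinct) (simp add: simple_graph_def)
qed

lemma path_covering_singletons: "path_covering G ((\<lambda>v. [v]) ` verts G)"
  by (auto simp: path_covering_def is_path_def)

end

theory Submission
  imports Defs "HOL-Library.Multiset"
begin

text \<open>Undoing a 2-switch is again a 2-switch, so it suffices to turn a covering of \<open>G\<close> into one
  of \<open>\<tau>(G)\<close> with at most one more path. If one of the removed edges \<open>ab\<close>, \<open>cd\<close> is not on a path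
  of the covering, cutting at the other one is enough. If both are used, cutting at both yields two
  additional paths, and the new edges \<open>ac\<close>, \<open>bd\<close> always rejoin at least two of the pieces.\<close>

section \<open>Coverings as lists of vertex sequences\<close>

text \<open>A path covering as a list of vertex sequences, some of which may be empty.\<close>

definition list_covering :: "'a set set \<Rightarrow> 'a set \<Rightarrow> 'a list list \<Rightarrow> bool" where
  "list_covering E V L \<longleftrightarrow>
     distinct (concat L) \<and> set (concat L) = V \<and> (\<forall>p \<in> set L. successively (\<lambda>u v. {u, v} \<in> E) p)"

text \<open>Monotonicity that keeps the position of the pair \<open>u\<close>, \<open>v\<close> in
  the list available, so an edge set may shrink as long as no lost edge is traversed.\<close>

lemma successively_weaken:
  assumes "successively P p"
    and "\<And>xs u v ys. p = xs @ u # v # ys \<Longrightarrow> P u v \<Longrightarrow> Q u v"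
  shows "successively Q p"
  using assms
proof (induction p)
  case (Cons x p)
  show ?case
  proof (cases p)
    case (Cons y q)
    have "successively Q p"
    proof (rule Cons.IH)
      show "successively P p" using Cons.prems(1) \<open>p = y # q\<close> by simp
      show "Q u v" if "p = xs @ u # v # ys" "P u v" for xs u v ys
        using Cons.prems(2)[of "x # xs" u v ys] that by simp
    qed
    moreover have "Q x y"
      using Cons.prems(1) Cons.prems(2)[of "[]" x y q] \<open>p = y # q\<close> by simp
    ultimately show ?thesis using \<open>p = y # q\<close> by simp
  qed simp
qed simp

lemma successively_edges_rev:
  "successively (\<lambda>u v. {u, v} \<in> E) (rev p) \<longleftrightarrow> successively (\<lambda>u v. {u, v} \<in> E) p"
  by (simp add: successively_rev insert_commute)

text \<open>Disjointness and coverage depend only on the multiset of all listed vertices, so after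
  cutting, reversing and regluing only adjacency remains to be checked.\<close>

lemma list_covering_rearrange:
  assumes "list_covering E V L" "mset (concat L') = mset (concat L)"
    and "\<forall>p \<in> set L'. successively (\<lambda>u v. {u, v} \<in> F) p"
  shows "list_covering F V L'"
  using assms unfolding list_covering_def
  by (metis mset_eq_imp_distinct_iff mset_eq_setD)

lemma list_covering_mset:
  assumes "list_covering E V L" "mset L' = mset L"
  shows "list_covering E V L'"
  using assms(1)
proof (rule list_covering_rearrange)
  show "mset (concat L') = mset (concat L)"
    using assms(2) by (metis mset_concat mset_map sum_mset_sum_list)
  show "\<forall>p \<in> set L'. successively (\<lambda>u v. {u, v} \<in> E) p"
    using assms mset_eq_setD[OF assms(2)] by (simp add: list_covering_def)
qed

lemma list_covering_mono:
  assumes "list_covering E V L" "E \<subseteq> F"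
  shows "list_covering F V L"
  using assms unfolding list_covering_def
  by (auto intro: successively_mono)

section \<open>Deleting an edge from a covering\<close>

lemma list_covering_unused:
  assumes "list_covering E V L"
    and "\<And>p xs ys. p \<in> set L \<Longrightarrow> p \<noteq> xs @ u # v # ys \<and> p \<noteq> xs @ v # u # ys"
  shows "list_covering (E - {{u, v}}) V L"
  unfolding list_covering_def
proof (intro conjI ballI)
  fix p assume p: "p \<in> set L"
  then have "successively (\<lambda>x y. {x, y} \<in> E) p"
    using assms(1) by (simp add: list_covering_def)
  then show "successively (\<lambda>x y. {x, y} \<in> E - {{u, v}}) p"
    by (rule successively_weaken) (use assms(2)[OF p] in \<open>auto simp: doubleton_eq_iff\<close>)
qed (use assms(1) in \<open>auto simp: list_covering_def\<close>)

lemma list_covering_delete_edge: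
  assumes "list_covering E V L"
  shows "\<exists>L'. list_covering (E - {{u, v}}) V L' \<and> length L' \<le> Suc (length L)"
proof (cases "\<forall>p \<in> set L. \<forall>xs ys. p \<noteq> xs @ u # v # ys \<and> p \<noteq> xs @ v # u # ys")
  case True
  then have "list_covering (E - {{u, v}}) V L"
    using assms by (intro list_covering_unused) auto
  then show ?thesis by auto
next
  case False
  \<comment> \<open>\<open>s\<close>, \<open>t\<close> are the ends \<open>u\<close>,
    \<open>v\<close> in the order in which \<open>p\<close> visits them.\<close>
  then obtain s t p xs ys where p: "p \<in> set L" "p = xs @ s # t # ys" and st: "{s, t} = {u, v}"
    by (metis insert_commute)
  obtain L1 L2 where L: "L = L1 @ p # L2"
    using p(1) by (meson split_list)
  define L' where "L' = L1 @ (xs @ [s]) # (t # ys) # L2"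
  have E: "list_covering E V L'"
    using assms by (rule list_covering_rearrange)
      (use assms in \<open>auto simp: L'_def L p list_covering_def successively_append_iff successively_Cons\<close>)
  \<comment> \<open>After the cut \<open>s\<close> and \<open>t\<close> lie in different lists; as
    no vertex repeats, no list contains both, so the edge is no longer traversed.\<close>
  have "distinct (concat L')"
    using E by (simp add: list_covering_def)
  then have "\<not> (s \<in> set q \<and> t \<in> set q)" if "q \<in> set L'" for q
    using that by (auto simp: L'_def)
  then have "list_covering (E - {{s, t}}) V L'"
    using E by (intro list_covering_unused) force+
  then show ?thesis
    using st by (intro exI[of _ L']) (simp add: L'_def L)
qed

section \<open>Switching two edges that are both traversed\<close>

text \<open>Two consecutive pairs in one list without a common vertex cannot overlap, so one pair
  lies entirely before the other.\<close>

lemma two_edges_on_path: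
  assumes "A @ a # b # B = C @ c # d # D" "{a, b} \<inter> {c, d} = {}"
  shows "(\<exists>M. B = M @ c # d # D) \<or> (\<exists>M. A = C @ c # d # M)"
  using assms
  by (auto simp: append_eq_append_conv2 Cons_eq_append_conv append_eq_Cons_conv)

text \<open>The edge set of a nontrivial \<open>two_switch\<close>, freed from the side
  conditions.\<close>

definition switched_edges :: "'a \<Rightarrow> 'a \<Rightarrow> 'a \<Rightarrow> 'a \<Rightarrow> 'a set set \<Rightarrow> 'a set set" where
  "switched_edges a b c d E = (E - {{a, b}, {c, d}}) \<union> {{a, c}, {b, d}}"

text \<open>Only the direction of the first edge is fixed. Whether one or two paths come back from
  the pieces, and at what cost, depends on the direction of the second edge and on whether
  \<open>p = q\<close>.\<close>

lemma list_covering_switch_both_used: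
  assumes cov: "list_covering E V L" and disj: "{a, b} \<inter> {c, d} = {}"
    and p: "p \<in> set L" "p = A @ a # b # B"
    and q: "q \<in> set L" "q = C @ c # d # D \<or> q = C @ d # c # D"
  shows "\<exists>L'. list_covering (switched_edges a b c d E) V L' \<and> length L' \<le> Suc (length L)"
proof -
  define F where "F = switched_edges a b c d E"
  define S where "S = successively (\<lambda>u v. {u, v} \<in> E)"
  define T where "T = successively (\<lambda>u v. {u, v} \<in> F)"
  \<comment> \<open>Every piece without both ends of a removed edge stays a path after the switch;
    this handles all pieces and all untouched paths.\<close>
  have keep: "T r" if "S r" "\<not> (a \<in> set r \<and> b \<in> set r)" "\<not> (c \<in> set r \<and> d \<in> set r)" for r
    using that(1) unfolding S_def T_def
    by (rule successively_weaken)
      (use that(2,3) in \<open>auto simp: F_def switched_edges_def doubleton_eq_iff\<close>)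
  have ac: "a \<in> set p" "c \<in> set q"
    using p(2) q(2) by auto
  have new: "{a, c} \<in> F" "{c, a} \<in> F" "{b, d} \<in> F" "{d, b} \<in> F"
    by (auto simp: F_def switched_edges_def insert_commute)
  have T_rev: "T (rev r) = T r" for r
    unfolding T_def by (rule successively_edges_rev)
  have T_join: "T (xs @ x # y # ys) \<longleftrightarrow> T (xs @ [x]) \<and> {x, y} \<in> F \<and> T (y # ys)" for xs x y ys
    by (auto simp: T_def successively_append_iff)
  have S_join: "S (xs @ x # y # ys) \<longleftrightarrow> S (xs @ [x]) \<and> {x, y} \<in> E \<and> S (y # ys)" for xs x y ys
    by (auto simp: S_def successively_append_iff)
  have finish: ?thesis
    if "mset (concat L') = mset (concat L)" "\<forall>r \<in> set L'. T r" "length L' \<le> Suc (length L)" for L'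
    using list_covering_rearrange[OF cov that(1)] that(2,3) by (auto simp: T_def F_def)
  show ?thesis
  proof (cases "p = q")
    \<comment> \<open>Different paths: both cuts give four pieces, and the two new edges join them
      into two paths, so the number of paths does not grow.\<close>
    case False
    then obtain R where R: "mset L = mset (p # q # R)"
      using p(1) q(1)
      by (metis ex_mset insert_DiffM mset.simps(2) set_mset_mset insert_noteq_member)
    have cov': "list_covering E V (p # q # R)"
      using cov R by (metis list_covering_mset)
    have dist: "distinct (concat (p # q # R))" and "S p" "S q" "\<forall>r \<in> set R. S r"
      using cov' by (auto simp: list_covering_def S_def)
    have len: "length L = Suc (Suc (length R))"
      using R by (metis length_Cons size_mset)
    have conc: "mset (concat L) = mset (p @ q @ concat R)"
      using R by (metis concat.simps(2) mset_concat mset_map sum_mset_sum_list)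
    have TR: "\<forall>r \<in> set R. T r"
      using dist ac \<open>\<forall>r \<in> set R. S r\<close> by (auto intro!: keep)
    have "T (A @ [a])" "T (b # B)"
      using dist q(2) \<open>S p\<close> by (auto simp: p(2) S_join intro!: keep)
    then have TAB: "T (A @ [a])" "T (rev B @ [b])"
      using T_rev[of "b # B"] by simp_all
    from q(2) show ?thesis
    proof
      assume q: "q = C @ c # d # D"
      have "T (C @ [c])" "T (d # D)"
        using dist \<open>S q\<close> by (auto simp: p(2) q S_join intro!: keep)
      then have "T (c # rev C)" "T (d # D)"
        using T_rev[of "C @ [c]"] by simp_all
      then show ?thesis
        using TAB TR new
        by (intro finish[of "(A @ a # c # rev C) # (rev B @ b # d # D) # R"])
          (simp_all add: conc len T_join p(2) q)
    next
      assume q: "q = C @ d # c # D"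
      have "T (C @ [d])" "T (c # D)"
        using dist \<open>S q\<close> by (auto simp: p(2) q S_join intro!: keep)
      then have "T (d # rev C)" "T (c # D)"
        using T_rev[of "C @ [d]"] by simp_all
      then show ?thesis
        using TAB TR new
        by (intro finish[of "(A @ a # c # D) # (rev B @ b # d # rev C) # R"])
          (simp_all add: conc len T_join p(2) q)
    qed
  next
    \<comment> \<open>Same path: the cuts give three pieces, and the relative direction of the two
      edges decides whether one or both new edges can join them.\<close>
    case True
    then obtain R where R: "mset L = mset (p # R)"
      using p(1) by (metis ex_mset insert_DiffM mset.simps(2) set_mset_mset)
    have cov': "list_covering E V (p # R)"
      using cov R by (metis list_covering_mset)
    have dist: "distinct (concat (p # R))" and "S p" "\<forall>r \<in> set R. S r"
      using cov' by (auto simp: list_covering_def S_def)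
    have len: "length L = Suc (length R)"
      using R by (metis length_Cons size_mset)
    have conc: "mset (concat L) = mset (p @ concat R)"
      using R by (metis concat.simps(2) mset_concat mset_map sum_mset_sum_list)
    have TR: "\<forall>r \<in> set R. T r"
      using dist ac True \<open>\<forall>r \<in> set R. S r\<close> by (auto intro!: keep)
    have "{a, b} \<inter> {d, c} = {}" using disj by blast
    then consider M where "B = M @ c # d # D" | M where "A = C @ c # d # M"
      | M where "B = M @ d # c # D" | M where "A = C @ d # c # M"
      using q(2) True p(2) two_edges_on_path disj by metis
    then show ?thesis
    proof cases
      \<comment> \<open>Equal directions: reversing the middle piece \<open>b # M @ [c]\<close> lets
        both new edges be used, and a single path results. The second case is symmetric.\<close>
      case (1 M)
      have "S (A @ [a])" "S ((b # M) @ [c])" "S (d # D)"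
        using \<open>S p\<close> S_join[of "b # M" c d D] by (auto simp: p(2) 1 S_join)
      then have "T (A @ [a])" "T (b # M @ [c])" "T (d # D)"
        using dist by (auto simp: p(2) 1 intro!: keep)
      then have "T (A @ [a])" "T (c # rev M @ [b])" "T (d # D)"
        using T_rev[of "b # M @ [c]"] by simp_all
      then show ?thesis
        using TR new T_join[of "c # rev M" b d D]
        by (intro finish[of "(A @ a # c # rev M @ b # d # D) # R"])
          (simp_all add: conc len T_join p(2) 1)
    next
      case (2 M)
      have "S (C @ [c])" "S (d # M @ [a])" "S (b # B)"
        using \<open>S p\<close> S_join[of "d # M" a b B] by (auto simp: p(2) 2 S_join)
      then have "T (C @ [c])" "T (d # M @ [a])" "T (b # B)"
        using dist by (auto simp: p(2) 2 intro!: keep)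
      then have "T (C @ [c])" "T (a # rev M @ [d])" "T (b # B)"
        using T_rev[of "d # M @ [a]"] by simp_all
      then show ?thesis
        using TR new T_join[of "a # rev M" d b B]
        by (intro finish[of "(C @ c # a # rev M @ d # b # B) # R"])
          (simp_all add: conc len T_join p(2) 2)
    next
      \<comment> \<open>Opposite directions: \<open>ac\<close> joins the outer pieces, but
        \<open>bd\<close> has both ends on the middle piece and merges nothing. The middle piece is
        the one additional path.\<close>
      case (3 M)
      have "S (A @ [a])" "S ((b # M) @ [d])" "S (c # D)"
        using \<open>S p\<close> S_join[of "b # M" d c D] by (auto simp: p(2) 3 S_join)
      then have "T (A @ [a])" "T (b # M @ [d])" "T (c # D)"
        using dist by (auto simp: p(2) 3 intro!: keep)
      then show ?thesis
        using TR new
        by (intro finish[of "(A @ a # c # D) # (b # M @ [d]) # R"])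
          (simp_all add: conc len T_join p(2) 3)
    next
      \<comment> \<open>Here \<open>bd\<close> joins the outer pieces and \<open>ac\<close> has both
        ends on the middle piece.\<close>
      case (4 M)
      have "S (C @ [d])" "S (c # M @ [a])" "S (b # B)"
        using \<open>S p\<close> S_join[of "c # M" a b B] by (auto simp: p(2) 4 S_join)
      then have "T (C @ [d])" "T (c # M @ [a])" "T (b # B)"
        using dist by (auto simp: p(2) 4 intro!: keep)
      then show ?thesis
        using TR new
        by (intro finish[of "(C @ d # b # B) # (c # M @ [a]) # R"])
          (simp_all add: conc len T_join p(2) 4)
    qed
  qed
qed

lemma list_covering_switch:
  assumes cov: "list_covering E V L" and disj: "{a, b} \<inter> {c, d} = {}"
  shows "\<exists>L'. list_covering (switched_edges a b c d E) V L' \<and> length L' \<le> Suc (length L)"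
proof -
  define used where "used = (\<lambda>u v. \<exists>p \<in> set L. \<exists>xs ys. p = xs @ u # v # ys)"
  \<comment> \<open>Dropping the untraversed edge is free and cutting at the other costs at most one
    path. The equation of sets of edges lets either removed edge play either role.\<close>
  have one: ?thesis if "\<not> used u v" "\<not> used v u" "{{u, v}, {s, t}} = {{a, b}, {c, d}}" for u v s t
  proof -
    have "list_covering (E - {{u, v}}) V L"
      using cov that(1,2) by (intro list_covering_unused) (auto simp: used_def)
    from list_covering_delete_edge[OF this, of s t] obtain L'
      where L': "list_covering (E - {{u, v}} - {{s, t}}) V L'" "length L' \<le> Suc (length L)"
      by blast
    have "E - {{u, v}} - {{s, t}} \<subseteq> switched_edges a b c d E"
      unfolding switched_edges_def that(3)[symmetric] by blast
    then show ?thesis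
      using L' list_covering_mono by blast
  qed
  consider "\<not> used a b" "\<not> used b a" | "\<not> used c d" "\<not> used d c"
    | "used a b" "used c d \<or> used d c" | "used b a" "used c d \<or> used d c"
    by blast
  then show ?thesis
  proof cases
    case 1
    then show ?thesis by (rule one) simp
  next
    case 2
    then show ?thesis by (rule one) (rule insert_commute)
  next
    case 3
    then show ?thesis
      using list_covering_switch_both_used[OF cov disj] unfolding used_def by blast
  next
    case 4
    \<comment> \<open>If the first edge is traversed from \<open>b\<close> to \<open>a\<close>,
      exchanging \<open>a\<close> with \<open>b\<close> and \<open>c\<close> with \<open>d\<close>
      gives the same switch and the required direction.\<close>
    have "{b, a} \<inter> {d, c} = {}" using disj by blast
    moreover have "switched_edges b a d c E = switched_edges a b c d E"
      by (simp add: switched_edges_def insert_commute)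
    ultimately show ?thesis
      using list_covering_switch_both_used[OF cov, of b a d c] 4 unfolding used_def by metis
  qed
qed

section \<open>From list coverings to the path-covering number\<close>

text \<open>Discarding the empty lists leaves a genuine path covering with at most
  \<open>length L\<close> paths.\<close>

lemma path_covering_number_le_length:
  assumes "list_covering (edges G) (verts G) L"
  shows "path_covering_number G \<le> length L"
proof -
  define P where "P = set (filter (\<lambda>p. p \<noteq> []) L)"
  have "(\<Union>p \<in> P. set p) = verts G"
    using assms by (fastforce simp: P_def list_covering_def)
  then have "path_covering G P"
    unfolding path_covering_def is_path_def
    using assms by (auto simp: P_def list_covering_def distinct_concat_iff)
  then have "path_covering_number G \<le> card P"
    unfolding path_covering_number_def by (intro Least_le) blast
  also have "card P \<le> length L"
    unfolding P_def by (meson card_length length_filter_le order_trans)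
  finally show ?thesis .
qed

lemma minimum_list_covering:
  assumes "simple_graph G"
  shows "\<exists>L. list_covering (edges G) (verts G) L \<and> length L = path_covering_number G"
proof -
  have "\<exists>P. path_covering G P \<and> card P = path_covering_number G"
    unfolding path_covering_number_def
    by (rule LeastI_ex) (use path_covering_singletons in blast)
  then obtain P where P: "path_covering G P" "card P = path_covering_number G"
    by blast
  obtain L where L: "set L = P" "distinct L"
    using finite_distinct_list finite_path_covering[OF assms P(1)] by blast
  have "distinct (concat L)"
    by (rule distinct_concat) (use P(1) L in \<open>auto simp: path_covering_def is_path_def\<close>)
  then have "list_covering (edges G) (verts G) L"
    using P(1) L by (auto simp: list_covering_def path_covering_def is_path_def)
  then show ?thesis
    using P(2) L distinct_card by metis
qed

lemma path_covering_number_two_switch_le: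
  assumes "simple_graph G"
  shows "path_covering_number (two_switch a b c d G) \<le> Suc (path_covering_number G)"
proof (cases "{a, b} \<inter> {c, d} = {} \<and> two_switch a b c d G \<noteq> G")
  case True
  then have H: "verts (two_switch a b c d G) = verts G"
      "edges (two_switch a b c d G) = switched_edges a b c d (edges G)"
    by (auto simp: two_switch_def switched_edges_def split: if_splits)
  obtain L where L: "list_covering (edges G) (verts G) L" "length L = path_covering_number G"
    using minimum_list_covering[OF assms] by blast
  then obtain L' where L': "length L' \<le> Suc (length L)"
      "list_covering (switched_edges a b c d (edges G)) (verts G) L'"
    using list_covering_switch True by metis
  then show ?thesis
    using path_covering_number_le_length[of "two_switch a b c d G" L'] H L(2) by simp
next
  case False
  then have "two_switch a b c d G = G"
    by (auto simp: two_switch_def)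
  then show ?thesis by simp
qed

text \<open>Exchanging the roles of \<open>b\<close> and \<open>c\<close> turns the added edges into
  the removed ones and conversely.\<close>

lemma two_switch_inverse:
  assumes "simple_graph G" "two_switch a b c d G \<noteq> G"
  shows "two_switch a c b d (two_switch a b c d G) = G"
proof -
  have sw: "{a, b} \<in> edges G" "{c, d} \<in> edges G" "{a, b} \<inter> {c, d} = {}"
      "{a, c} \<notin> edges G" "{b, d} \<notin> edges G"
    using assms(2) by (auto simp: two_switch_def split: if_splits)
  \<comment> \<open>Edges have two distinct ends, which makes \<open>{a, c}\<close> and
    \<open>{b, d}\<close> disjoint, as the reverse switch requires.\<close>
  have "a \<noteq> b" "c \<noteq> d"
    using assms(1) sw(1,2) by (auto simp: simple_graph_def)
  then have "(edges G - {{a, b}, {c, d}} \<union> {{a, c}, {b, d}}) - {{a, c}, {b, d}} \<union> {{a, b}, {c, d}}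
      = edges G"
    using sw by (auto simp: doubleton_eq_iff)
  then show ?thesis
    using sw \<open>a \<noteq> b\<close> \<open>c \<noteq> d\<close> by (auto simp: two_switch_def doubleton_eq_iff)
qed

theorem theorem12:
  fixes G :: "'a ugraph" and a b c d :: 'a
  assumes "simple_graph G"
  shows "\<bar>int (path_covering_number (two_switch a b c d G)) - int (path_covering_number G)\<bar> \<le> 1"
proof (cases "two_switch a b c d G = G")
  case False
  \<comment> \<open>The same one-sided bound, applied to the switched graph and the reverse switch
    \<open>a c b d\<close>.\<close>
  have "path_covering_number G \<le> Suc (path_covering_number (two_switch a b c d G))"
    using path_covering_number_two_switch_le[OF simple_graph_two_switch[OF assms], of a c b d a b c d]
      two_switch_inverse[OF assms False] by simp
  then show ?thesis
    using path_covering_number_two_switch_le[OF assms, of a b c d] by simp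
qed simp

end
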